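(* (Decay at infinity) Let $n\ge 2$, $0<\alpha,\beta<2$, $\lambda\in\mathbb{R}$, and let $\Omega$ be an unbounded region in $\Sigma_\lambda=\{x\in\mathbb{R}^n: x_1<\lambda\}$. Let $U_\lambda(x)=u(x^\lambda)-u(x)$ and $V_\lambda(x)=v(x^\lambda)-v(x)$ for functions $u,v:\mathbb{R}^n\to\mathbb{R}$. Assume that $U_\lambda\in L_\alpha\cap C^{1,1}_{loc}(\Omega)$ and $V_\lambda\in L_\beta\cap C^{1,1}_{loc}(\Omega)$ are lower semi-continuous on $\overline{\Omega}$ and satisfy $$\begin{cases}(-\Delta)^{\frac{\alpha}{2}}U_\lambda(x)+C_2(x)U_\lambda(x)+C_3(x)V_\lambda(x)\geq 0, & x\in\Omega,\\ (-\Delta)^{\frac{\beta}{2}}V_\lambda(x)+C_1(x)U_\lambda(x)\geq 0, & x\in\Omega,\\ U_\lambda(x)\geq 0,\quad V_\lambda(x)\geq 0, & x\in\Sigma_\lambda\setminus\Omega,\\ U_\lambda(x^\lambda)=-U_\lambda(x),\quad V_\lambda(x^\lambda)=-V_\lambda(x), & x\in\Sigma_\lambda,\end{cases}$$ where $C_1,C_2,C_3$ are functions on $\Omega$ with $C_1(x)<0$, $C_3(x)<0$, $C_2(x)>0$, such that, for some (arbitrary) $m>\beta$, $$|C_1(x)|\sim\frac{1}{|x|^{m}}\quad\text{for } |x| \text{ sufficiently large},$$ and $$\lim_{|x|\to\infty}C_3(x)=0.$$ Then there exists a constant $R_0>0$ such that if $x^0,x^1\in\Omega$ satisfy $$U_\lambda(x^0)=\min_{\Omega}U_\lambda(x)<0\quad\text{and}\quad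 V_\lambda(x^1)=\min_{\Omega}V_\lambda(x)<0,$$ then at least one of $x^0$ and $x^1$ satisfies $|x|\leq R_0$.
   Context: For $x=(x_1,x_2,\dots,x_n)\in\mathbb{R}^n$, $x^\lambda=(2\lambda-x_1,x_2,\dots,x_n)$ is the reflection of $x$ about the plane $T_\lambda=\{x\in\mathbb{R}^n:x_1=\lambda\}$. For $0<\alpha<2$, $L_\alpha=\{u\in L^1_{loc}(\mathbb{R}^n):\int_{\mathbb{R}^n}\frac{|u(x)|}{1+|x|^{n+\alpha}}dx<\infty\}$. The fractional Laplacian is $$(-\Delta)^{\frac{\alpha}{2}}u(x)=C_{n,\alpha}\,PV\int_{\mathbb{R}^n}\frac{u(x)-u(y)}{|x-y|^{n+\alpha}}dy=C_{n,\alpha}\lim_{\varepsilon\to0^+}\int_{\mathbb{R}^n\setminus B_\varepsilon(x)}\frac{u(x)-u(y)}{|x-y|^{n+\alpha}}dy,$$ where $C_{n,\alpha}>0$ is the usual normalization constant; it is well defined at points near which $u$ is $C^{1,1}$ when $u\in L_\alpha$. The same definitions are used with $\beta$ in place of $\alpha$. The notation $f(x)\sim g(x)$ for $|x|$ large means that $f/g$ is bounded above and below by positive constants for $|x|$ large. *)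

theory Defs
  imports "HOL-Analysis.Analysis"
begin

text \<open>The index \<open>k\<close> names the coordinate direction that is written \<open>x\<^sub>1\<close> on paper: a
  finite index type need not have a distinguished first element.\<close>

definition reflect :: "'n::finite \<Rightarrow> real \<Rightarrow> real ^ 'n \<Rightarrow> real ^ 'n" where
  "reflect k lam x = (\<chi> i. if i = k then 2 * lam - x $ k else x $ i)"

definition half_space :: "'n::finite \<Rightarrow> real \<Rightarrow> (real ^ 'n) set" where
  "half_space k lam = {x. x $ k < lam}"

definition region :: "'a::topological_space set \<Rightarrow> bool" where
  "region S \<longleftrightarrow> open S \<and> connected S \<and> S \<noteq> {}"

definition L1_loc :: "(real ^ 'n::finite \<Rightarrow> real) set" where
  "L1_loc = {u. \<forall>K. compact K \<longrightarrow> set_integrable lebesgue K u}"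

definition L_space :: "real \<Rightarrow> (real ^ 'n::finite \<Rightarrow> real) set" where
  "L_space \<alpha> = {u \<in> L1_loc.
     integrable lebesgue (\<lambda>x. \<bar>u x\<bar> / (1 + norm x powr (real CARD('n) + \<alpha>)))}"

text \<open>\<open>C\<^sup>1\<^sup>,\<^sup>1\<close> locally on an open set: differentiable with locally Lipschitz gradient.\<close>

definition C11_loc :: "(real ^ 'n::finite) set \<Rightarrow> (real ^ 'n \<Rightarrow> real) set" where
  "C11_loc S = {u. \<exists>g. (\<forall>x\<in>S. GDERIV u x :> g x) \<and>
     (\<forall>x\<in>S. \<exists>r>0. \<exists>L. ball x r \<subseteq> S \<and> L-lipschitz_on (ball x r) g)}"

definition lower_semicontinuous_on :: "'a::topological_space set \<Rightarrow> ('a \<Rightarrow> real) \<Rightarrow> bool" where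
  "lower_semicontinuous_on S f \<longleftrightarrow>
     (\<forall>x\<in>S. \<forall>a. a < f x \<longrightarrow> (\<forall>\<^sub>F y in at x within S. a < f y))"

text \<open>The usual normalization, in closed form with respect to the dimension \<open>n\<close>; it is the
  constant for which \<open>(-\<Delta>)\<^sup>\<alpha>\<^sup>/\<^sup>2\<close> has Fourier symbol \<open>\<bar>\<xi>\<bar>\<^sup>\<alpha>\<close>, i.e. the reciprocal of
  \<open>\<integral> (1 - cos \<zeta>\<^sub>1) / \<bar>\<zeta>\<bar>\<^sup>n\<^sup>+\<^sup>\<alpha> d\<zeta>\<close>.\<close>

definition frac_const :: "nat \<Rightarrow> real \<Rightarrow> real" where
  "frac_const n \<alpha> = \<alpha> * 2 powr (\<alpha> - 1) * Gamma ((real n + \<alpha>) / 2) /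
     (pi powr (real n / 2) * Gamma (1 - \<alpha> / 2))"

text \<open>\<open>frac_laplacian \<alpha> u x\<close> is \<open>(-\<Delta>)\<^sup>\<alpha>\<^sup>/\<^sup>2 u(x)\<close>; the value is meaningful only where the
  principal value exists.\<close>

definition frac_laplacian :: "real \<Rightarrow> (real ^ 'n::finite \<Rightarrow> real) \<Rightarrow> real ^ 'n \<Rightarrow> real" where
  "frac_laplacian \<alpha> u x = frac_const CARD('n) \<alpha> *
     Lim (at_right 0) (\<lambda>\<epsilon>. LINT y : - ball x \<epsilon> | lebesgue.
       (u x - u y) / norm (x - y) powr (real CARD('n) + \<alpha>))"

text \<open>Asymptotic behaviour of functions given on an unbounded set: only points of \<open>S\<close> count.\<close>

definition at_infinity_within :: "'a::real_normed_vector set \<Rightarrow> 'a filter" where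
  "at_infinity_within S = inf at_infinity (principal S)"

definition comparable :: "'a filter \<Rightarrow> ('a \<Rightarrow> real) \<Rightarrow> ('a \<Rightarrow> real) \<Rightarrow> bool" where
  "comparable F f g \<longleftrightarrow> (\<exists>c>0. \<exists>C>0. \<forall>\<^sub>F x in F. c \<le> f x / g x \<and> f x / g x \<le> C)"

end

theory Submission
  imports Defs
begin

text \<open>The radius may depend on \<open>U\<close> and \<open>V\<close>, so the two negative minimal values \<open>\<mu>\<^sub>U\<close> and
  \<open>\<mu>\<^sub>V\<close> are fixed numbers and the inequality for \<open>V\<close> alone bounds every minimum point \<open>x\<close> of
  \<open>V\<close>. Since the gradient of \<open>V\<close> vanishes at \<open>x\<close>, the singular integral converges absolutely,
  so it equals half the integral of its integrand \<open>f\<close> symmetrized by the reflection. Antisymmetry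
  and minimality make the symmetrized integrand nonpositive everywhere and at most
  \<open>2 \<mu>\<^sub>V / \<bar>x - y\<bar>\<^sup>n\<^sup>+\<^sup>\<beta>\<close> on the far side of the plane; a ball there of radius comparable to
  \<open>\<bar>x\<bar>\<close> gives \<open>(-\<Delta>)\<^sup>\<beta>\<^sup>/\<^sup>2 V(x) \<le> c \<mu>\<^sub>V \<bar>x\<bar>\<^sup>-\<^sup>\<beta>\<close>. The inequality for \<open>V\<close> then reads
  \<open>c \<bar>\<mu>\<^sub>V\<bar> \<bar>x\<bar>\<^sup>-\<^sup>\<beta> \<le> C \<bar>\<mu>\<^sub>U\<bar> \<bar>x\<bar>\<^sup>-\<^sup>m\<close>, which bounds \<open>\<bar>x\<bar>\<close> because \<open>m > \<beta>\<close>.\<close>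

section \<open>Reflection about the plane and Lebesgue measure\<close>

lemma reflect_reflect [simp]: "reflect k lam (reflect k lam x) = x"
  by (simp add: reflect_def vec_eq_iff)

text \<open>The reflection is a translation composed with a diagonal linear map whose entries, the
  values of \<open>c\<close> on the basis, are 1 or -1. Its Jacobian therefore has absolute value
  1.\<close>

lemma
  fixes k :: "'n::finite" and lam :: real
  shows distr_lebesgue_reflect: "distr lebesgue lebesgue (reflect k lam) = lebesgue"
    and measurable_reflect [measurable]: "reflect k lam \<in> lebesgue \<rightarrow>\<^sub>M lebesgue"
proof -
  define c :: "real ^ 'n \<Rightarrow> real" where "c j = (if j = axis k 1 then -1 else 1)" for j
  define t :: "real ^ 'n" where "t = axis k (2 * lam)"
  have cax: "c (axis i 1) = (if i = k then -1 else 1)" for i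
    by (simp add: c_def axis_eq_axis)
  have "reflect k lam = (\<lambda>x. t + (\<Sum>j\<in>Basis. (c j * (x \<bullet> j)) *\<^sub>R j))"
  proof
    fix x :: "real ^ 'n"
    have "(t + (\<Sum>j\<in>Basis. (c j * (x \<bullet> j)) *\<^sub>R j)) \<bullet> axis i 1 = reflect k lam x \<bullet> axis i 1" for i
    proof -
      have "(\<Sum>j\<in>Basis. (c j * (x \<bullet> j)) *\<^sub>R j) \<bullet> axis i 1 = c (axis i 1) * (x \<bullet> axis i 1)"
        by (subst inner_sum_left_Basis) (auto simp: Basis_vec_def)
      then show ?thesis
        by (simp add: inner_add_left cax t_def reflect_def inner_axis) (simp add: axis_def)
    qed
    then show "reflect k lam x = t + (\<Sum>j\<in>Basis. (c j * (x \<bullet> j)) *\<^sub>R j)"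
      by (simp add: vec_eq_iff inner_axis)
  qed
  moreover have "c j \<noteq> 0" for j by (simp add: c_def)
  moreover have "(\<Prod>j\<in>Basis. \<bar>c j\<bar>) = 1" by (rule prod.neutral) (simp add: c_def)
  ultimately show "distr lebesgue lebesgue (reflect k lam) = lebesgue"
    and "reflect k lam \<in> lebesgue \<rightarrow>\<^sub>M lebesgue"
    using lebesgue_affine_euclidean[of c t] lebesgue_affine_measurable[of c t]
    by (simp_all add: density_1)
qed

section \<open>Integrability of powers by dyadic decomposition\<close>

text \<open>The function is dominated by a series of step functions on concentric balls, whose
  integral is the given series times the volume of the unit ball. The radii may grow or shrink with
  \<open>j\<close>, so the criterion serves both at infinity and at a singularity.\<close>

lemma integrable_dyadic:
  fixes w :: "'a::euclidean_space \<Rightarrow> real" and a \<rho> :: "nat \<Rightarrow> real"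
  assumes [measurable]: "w \<in> borel_measurable lebesgue"
    and a: "\<And>j. a j \<ge> 0" and \<rho>: "\<And>j. \<rho> j \<ge> 0"
    and summ: "summable (\<lambda>j. a j * \<rho> j ^ DIM('a))"
    and w: "\<And>y. w y \<noteq> 0 \<Longrightarrow> \<exists>j. dist x y \<le> \<rho> j \<and> \<bar>w y\<bar> \<le> a j"
  shows "integrable lebesgue w"
proof (rule integrableI_bounded)
  have "(\<integral>\<^sup>+y. norm (w y) \<partial>lebesgue)
      \<le> (\<integral>\<^sup>+y. (\<Sum>j. ennreal (a j) * indicator (cball x (\<rho> j)) y) \<partial>lebesgue)"
  proof (rule nn_integral_mono)
    fix y
    show "ennreal (norm (w y)) \<le> (\<Sum>j. ennreal (a j) * indicator (cball x (\<rho> j)) y)"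
    proof (cases "w y = 0")
      case False
      then obtain j where "dist x y \<le> \<rho> j" "\<bar>w y\<bar> \<le> a j"
        using w by blast
      then have "ennreal (norm (w y)) \<le> (\<Sum>i\<in>{j}. ennreal (a i) * indicator (cball x (\<rho> i)) y)"
        by (simp add: ennreal_leI)
      also have "\<dots> \<le> (\<Sum>j. ennreal (a j) * indicator (cball x (\<rho> j)) y)"
        by (rule sum_le_suminf) auto
      finally show ?thesis .
    qed simp
  qed
  also have "\<dots> = (\<Sum>j. \<integral>\<^sup>+y. ennreal (a j) * indicator (cball x (\<rho> j)) y \<partial>lebesgue)"
    by (intro nn_integral_suminf measurable_completion borel_measurable_times_ennreal
        borel_measurable_const borel_measurable_indicator) auto
  also have "\<dots> = (\<Sum>j. ennreal (unit_ball_vol DIM('a) * (a j * \<rho> j ^ DIM('a))))"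
    using a \<rho> by (simp add: nn_integral_cmult_indicator emeasure_cball ennreal_mult' mult_ac)
  also have "\<dots> < \<infinity>"
    using summable_mult[OF summ, of "unit_ball_vol DIM('a)"] a \<rho>
    by (subst suminf_ennreal2) (auto intro!: mult_nonneg_nonneg)
  finally show "(\<integral>\<^sup>+y. norm (w y) \<partial>lebesgue) < \<infinity>" .
qed measurable

text \<open>On the shell between radii \<open>2 ^ (j - 1)\<close> and \<open>2 ^ j\<close> the
  integrand is at most \<open>(2 ^ (j - 1)) powr -p\<close>. Weighted by volume this is a geometric
  series of ratio \<open>2 powr (DIM('a) - p)\<close>.\<close>

lemma integrable_inverse_power_at_infinity:
  fixes p :: real
  assumes p: "p > DIM('a)"
  shows "integrable lebesgue (\<lambda>y::'a::euclidean_space. 1 / (1 + norm y powr p))"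
proof (rule integrable_dyadic[where x = 0 and \<rho> = "\<lambda>j. 2 ^ j" and a = "\<lambda>j. 2 powr p * (2 ^ j) powr -p"])
  have eq: "2 powr p * (2 ^ j) powr -p * (2 ^ j) ^ DIM('a) = 2 powr p * (2 powr (DIM('a) - p)) ^ j" for j :: nat
    by (simp add: powr_realpow[symmetric] powr_powr powr_add[symmetric] algebra_simps)
  have "2 powr (DIM('a) - p) < 2 powr (0::real)"
    using p by (intro powr_less_mono) auto
  then show "summable (\<lambda>j. 2 powr p * (2 ^ j) powr -p * (2 ^ j) ^ DIM('a))"
    unfolding eq by (intro summable_mult summable_geometric) auto
  show "\<exists>j. dist 0 y \<le> 2 ^ j \<and> \<bar>1 / (1 + norm y powr p)\<bar> \<le> 2 powr p * (2 ^ j) powr -p" for y :: 'a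
  proof -
    have pp: "p > 0" using p by (meson le_less_trans of_nat_0_le_iff)
    obtain n where "norm y < 2 ^ n"
      using real_arch_pow[of 2 "norm y"] by auto
    then have ex: "norm y \<le> 2 ^ n" by simp
    define j where "j = (LEAST n. norm y \<le> 2 ^ n)"
    have j: "norm y \<le> 2 ^ j"
      unfolding j_def using ex by (rule LeastI)
    have pos: "1 + norm y powr p > 0" by (smt (verit) powr_ge_zero)
    have "1 / (1 + norm y powr p) \<le> 2 powr p * (2 ^ j) powr -p"
    \<comment> \<open>For \<open>j = 0\<close> there is no inner radius, and the trivial bound 1
      suffices because \<open>2 powr p\<close> is at least 1. Otherwise leastness of
      \<open>j\<close> supplies the inner radius.\<close>
    proof (cases j)
      case 0
      have "1 \<le> 2 powr p" using pp by (simp add: ge_one_powr_ge_zero)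
      moreover have "1 / (1 + norm y powr p) \<le> 1" by (simp add: pos)
      ultimately show ?thesis by (simp add: 0)
    next
      case (Suc i)
      then have "\<not> norm y \<le> 2 ^ i"
        unfolding j_def by (metis lessI not_less_Least)
      then have "(2 ^ i) powr p \<le> norm y powr p"
        using pp by (intro powr_mono2) auto
      then have "1 / (1 + norm y powr p) \<le> 1 / (2 ^ i) powr p"
        using pos by (intro divide_left_mono) auto
      also have "\<dots> = 2 powr p * (2 ^ j) powr -p"
        by (simp add: Suc powr_minus powr_mult field_simps)
      finally show ?thesis .
    qed
    then show ?thesis using j pos by auto
  qed
  show "(\<lambda>y::'a. 1 / (1 + norm y powr p)) \<in> borel_measurable lebesgue"
    by (intro measurable_completion) measurable
qed auto

text \<open>On each dyadic shell the numerator is bounded at the outer radius and the denominator at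
  the inner one. Times the volume, this decays like \<open>((1/2) powr (2 - s)) ^ j\<close>, which
  is summable because \<open>s < 2\<close>.\<close>

lemma integrable_power_near_point:
  fixes f :: "'a::euclidean_space \<Rightarrow> real" and s r L :: real
  assumes [measurable]: "f \<in> borel_measurable lebesgue"
    and "0 < s" "s < 2" "r > 0"
    and f: "\<And>y. dist x y < r \<Longrightarrow> \<bar>f y\<bar> \<le> L * (dist x y)\<^sup>2 / dist x y powr (DIM('a) + s)"
  shows "integrable lebesgue (\<lambda>y. indicator (ball x r) y * f y)"
proof (rule integrable_dyadic[where x = x and \<rho> = "\<lambda>j. r * (1 / 2) ^ j"
      and a = "\<lambda>j. \<bar>L\<bar> * (r * (1/2)^j)\<^sup>2 / (r * (1/2) ^ Suc j) powr (DIM('a) + s)"])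
  let ?n = "real DIM('a)"
  have eq: "\<bar>L\<bar> * (r * (1/2)^j)\<^sup>2 / (r * (1/2) ^ Suc j) powr (?n + s) * (r * (1/2)^j) ^ DIM('a)
      = \<bar>L\<bar> * 2 powr (?n + s) * r powr (2 - s) * ((1/2) powr (2 - s)) ^ j" for j :: nat
  proof -
    define q where "q = r * (1/2) ^ j"
    have q: "q > 0" using \<open>r > 0\<close> by (simp add: q_def)
    have "(r * (1/2) ^ Suc j) powr (?n + s) = q powr (?n + s) / 2 powr (?n + s)"
      using q powr_divide[of q 2 "?n + s"] by (simp add: q_def)
    then have "\<bar>L\<bar> * q\<^sup>2 / (r * (1/2) ^ Suc j) powr (?n + s) * q ^ DIM('a)
      = \<bar>L\<bar> * 2 powr (?n + s) * (q powr 2 / q powr (?n + s) * q powr ?n)"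
      using q by (simp add: powr_realpow)
    also have "q powr 2 / q powr (?n + s) * q powr ?n = q powr (2 - s)"
      by (simp add: powr_add[symmetric] powr_diff[symmetric])
    also have "\<dots> = r powr (2 - s) * ((1/2) powr (2 - s)) ^ j"
      using \<open>r > 0\<close> by (simp add: q_def powr_mult powr_powr powr_realpow[symmetric] mult_ac)
    finally show ?thesis by (simp add: q_def)
  qed
  have "(1/2) powr (2 - s) < 1"
    using powr_less_mono'[of "1/2" 0 "2 - s"] \<open>s < 2\<close> by simp
  then show "summable (\<lambda>j. \<bar>L\<bar> * (r * (1/2)^j)\<^sup>2 / (r * (1/2) ^ Suc j) powr (?n + s) * (r * (1/2)^j) ^ DIM('a))"
    unfolding eq by (intro summable_mult summable_geometric) auto
  have [measurable]: "ball x r \<in> sets lebesgue" by auto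
  show "(\<lambda>y. indicator (ball x r) y * f y) \<in> borel_measurable lebesgue"
    by measurable
  fix y assume nz: "indicator (ball x r) y * f y \<noteq> 0"
  then have y: "dist x y < r" "f y \<noteq> 0" by (auto simp: indicator_def split: if_splits)
  \<comment> \<open>At \<open>y = x\<close> the right side of the assumed bound is 0, so
    \<open>f\<close> vanishes there.\<close>
  have "x \<noteq> y" using f[of y] y by auto
  define t where "t = dist x y"
  have t: "0 < t" "t < r" using y \<open>x \<noteq> y\<close> by (auto simp: t_def)
  obtain n where "(1/2) ^ n < t / r"
    using real_arch_pow_inv[of "t/r" "1/2"] t by auto
  then have ex: "r * (1/2) ^ n < t" using t by (simp add: field_simps)
  \<comment> \<open>Since \<open>t < r\<close>, the least index with radius below \<open>t\<close>
    is not 0. Its predecessor \<open>j\<close> gives the outer radius of the shell containing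
    \<open>y\<close>.\<close>
  define N where "N = (LEAST n. r * (1/2) ^ n < t)"
  have N: "r * (1/2) ^ N < t" unfolding N_def using ex by (rule LeastI)
  then obtain j where j: "N = Suc j" using t by (cases N) auto
  then have up: "t \<le> r * (1/2) ^ j"
    unfolding N_def by (metis lessI not_le not_less_Least)
  have low: "r * (1/2) ^ Suc j < t" using N j by simp
  have "\<bar>indicator (ball x r) y * f y\<bar> \<le> \<bar>f y\<bar>"
    by (simp add: indicator_def)
  also have "\<dots> \<le> L * t\<^sup>2 / t powr (?n + s)"
    using f y by (simp add: t_def)
  also have "\<dots> \<le> \<bar>L\<bar> * t\<^sup>2 / t powr (?n + s)"
    by (intro divide_right_mono mult_right_mono) auto
  also have "\<dots> \<le> \<bar>L\<bar> * (r * (1/2)^j)\<^sup>2 / (r * (1/2) ^ Suc j) powr (?n + s)"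
  proof (rule frac_le)
    show "\<bar>L\<bar> * t\<^sup>2 \<le> \<bar>L\<bar> * (r * (1/2)^j)\<^sup>2"
      using up t by (intro mult_left_mono power_mono) auto
    show "(r * (1/2) ^ Suc j) powr (?n + s) \<le> t powr (?n + s)"
      using low \<open>r > 0\<close> \<open>0 < s\<close> by (intro powr_mono2) auto
  qed (use \<open>r > 0\<close> in auto)
  finally show "\<exists>j. dist x y \<le> r * (1/2) ^ j \<and> \<bar>indicator (ball x r) y * f y\<bar>
      \<le> \<bar>L\<bar> * (r * (1/2)^j)\<^sup>2 / (r * (1/2) ^ Suc j) powr (?n + s)"
    using up unfolding t_def by blast
qed (use \<open>r > 0\<close> in \<open>auto intro!: divide_nonneg_nonneg\<close>)

section \<open>Absolute convergence of the singular integral at a minimum\<close>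

lemma L1_loc_measurable:
  fixes u :: "real ^ 'n::finite \<Rightarrow> real"
  assumes "u \<in> L1_loc"
  shows "u \<in> borel_measurable lebesgue"
proof (rule borel_measurable_LIMSEQ_real)
  fix i :: nat
  have "set_integrable lebesgue (cball 0 (real i)) u"
    using assms by (auto simp: L1_loc_def)
  then show "(\<lambda>x. indicator (cball 0 (real i)) x * u x) \<in> borel_measurable lebesgue"
    by (auto simp: set_integrable_def)
next
  fix x :: "real ^ 'n"
  have "\<forall>\<^sub>F i in sequentially. indicator (cball 0 (real i)) x * u x = u x"
    using eventually_ge_at_top[of "nat \<lceil>norm x\<rceil>"]
    by eventually_elim (auto simp: indicator_def nat_ceiling_le_eq)
  then show "(\<lambda>i. indicator (cball 0 (real i)) x * u x) \<longlonglongrightarrow> u x"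
    by (rule tendsto_eventually)
qed

text \<open>If the integrand is integrable, it dominates its own truncations, so the limit behind
  \<open>Lim\<close> exists and is the full integral. The substitution of \<open>inverse t\<close>
  for the truncation radius turns it into a limit at \<open>at_top\<close>.\<close>

lemma frac_laplacian_eq_integral:
  fixes u :: "real ^ 'n::finite \<Rightarrow> real" and \<alpha> :: real
  defines "f x y \<equiv> (u x - u y) / norm (x - y) powr (real CARD('n) + \<alpha>)"
  assumes int: "integrable lebesgue (f x)"
  shows "frac_laplacian \<alpha> u x = frac_const CARD('n) \<alpha> * (LINT y|lebesgue. f x y)"
proof -
  have [measurable]: "f x \<in> borel_measurable lebesgue" using int by auto
  have [measurable]: "ball x \<rho> \<in> sets lebesgue" for \<rho> by auto
  have "((\<lambda>t. LINT y|lebesgue. indicator (- ball x (inverse t)) y * f x y) \<longlongrightarrow> (LINT y|lebesgue. f x y)) at_top"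
  proof (rule integral_dominated_convergence_at_top[where w = "\<lambda>y. \<bar>f x y\<bar>"])
    have "((\<lambda>t. indicator (- ball x (inverse t)) y * f x y) \<longlongrightarrow> f x y) at_top" for y
    proof (cases "y = x")
      case False
      have "\<forall>\<^sub>F t in at_top. indicator (- ball x (inverse t)) y * f x y = f x y"
        using eventually_ge_at_top[of "inverse (dist x y)"]
      proof eventually_elim
        case (elim t)
        then have "inverse t \<le> dist x y"
          using False le_imp_inverse_le[of "inverse (dist x y)" t] by simp
        then show ?case by (simp add: indicator_def)
      qed
      then show ?thesis by (rule tendsto_eventually)
    qed (simp add: f_def)
    then show "AE y in lebesgue. ((\<lambda>t. indicator (- ball x (inverse t)) y * f x y) \<longlongrightarrow> f x y) at_top"
      by simp
    show "\<forall>\<^sub>F t in at_top. AE y in lebesgue. norm (indicator (- ball x (inverse t)) y * f x y) \<le> \<bar>f x y\<bar>"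
      by (auto simp: indicator_def)
    show "(\<lambda>y. indicator (- ball x (inverse t)) y * f x y) \<in> borel_measurable lebesgue" for t
      by measurable
  qed (use int in auto)
  then have "((\<lambda>\<epsilon>. LINT y : - ball x \<epsilon> | lebesgue. f x y) \<longlongrightarrow> (LINT y|lebesgue. f x y)) (at_right 0)"
    unfolding filterlim_at_right_to_top set_lebesgue_integral_def by simp
  then show ?thesis
    unfolding frac_laplacian_def f_def by (subst tendsto_Lim) auto
qed

text \<open>The gradient vanishes at an interior minimum, so its Lipschitz bound makes it at most
  linear in the distance; the mean value inequality then gives quadratic growth.\<close>

lemma C11_loc_minimum_quadratic:
  fixes u :: "real ^ 'n::finite \<Rightarrow> real"
  assumes u: "u \<in> C11_loc S" and "x \<in> S" and min: "\<And>y. y \<in> S \<Longrightarrow> u x \<le> u y"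
  obtains r L where "r > 0" "\<And>y. dist x y < r \<Longrightarrow> \<bar>u x - u y\<bar> \<le> L * (dist x y)\<^sup>2"
proof -
  obtain g where g: "\<And>y. y \<in> S \<Longrightarrow> GDERIV u y :> g y"
    and "\<exists>r>0. \<exists>L. ball x r \<subseteq> S \<and> L-lipschitz_on (ball x r) g"
    using u \<open>x \<in> S\<close> unfolding C11_loc_def by blast
  then obtain r L where r: "r > 0" "ball x r \<subseteq> S" and L: "L-lipschitz_on (ball x r) g"
    by blast
  have der: "(u has_derivative (\<lambda>h. inner h (g y))) (at y)" if "y \<in> ball x r" for y
    using g r that by (auto simp: gderiv_def)
  have "(\<lambda>h. inner h (g x)) = (\<lambda>h. 0)"
    using r der min by (intro differential_zero_maxmin[where S = "ball x r" and f = u]) auto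
  then have gx: "g x = 0"
    by (metis inner_eq_zero_iff)
  show thesis
  proof (rule that[OF \<open>r > 0\<close>])
    fix y assume y: "dist x y < r"
    \<comment> \<open>The ball of radius \<open>dist x y\<close>, not \<open>r\<close>, is used so
      that the bound on the derivative carries the second factor \<open>dist x y\<close>.\<close>
    have "norm (u y - u x) \<le> (L * dist x y) * norm (y - x)"
    proof (rule differentiable_bound[where S = "cball x (dist x y)" and f' = "\<lambda>z h. inner h (g z)"])
      fix z assume z: "z \<in> cball x (dist x y)"
      then have "z \<in> ball x r" using y by auto
      then show "(u has_derivative (\<lambda>h. inner h (g z))) (at z within cball x (dist x y))"
        using der has_derivative_at_withinI by blast
      have "norm (g z) \<le> L * dist x z"
        using lipschitz_onD[OF L \<open>z \<in> ball x r\<close>, of x] r gx by (simp add: dist_norm norm_minus_commute)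
      also have "\<dots> \<le> L * dist x y"
        using z lipschitz_on_nonneg[OF L] by (intro mult_left_mono) auto
      finally have gz: "norm (g z) \<le> L * dist x y" .
      show "onorm (\<lambda>h. inner h (g z)) \<le> L * dist x y"
      proof (rule onorm_le)
        fix h
        have "norm (inner h (g z)) \<le> norm h * norm (g z)"
          by (simp add: Cauchy_Schwarz_ineq2)
        also have "\<dots> \<le> norm h * (L * dist x y)"
          using gz by (intro mult_left_mono) auto
        finally show "norm (inner h (g z)) \<le> L * dist x y * norm h"
          by (simp add: mult_ac)
      qed
    qed auto
    then show "\<bar>u x - u y\<bar> \<le> L * (dist x y)\<^sup>2"
      by (simp add: dist_norm norm_minus_commute abs_minus_commute power2_eq_square mult_ac)
  qed
qed

text \<open>Near \<open>x\<close> the quadratic bound tames the kernel since \<open>s < 2\<close>.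
  Away from \<open>x\<close> the kernel is bounded by a multiple of the weight in
  \<open>L_space\<close>, which handles \<open>u y\<close> by assumption and the constant
  \<open>u x\<close> because the exponent exceeds the dimension.\<close>

lemma integrable_difference_quotient_at_minimum:
  fixes u :: "real ^ 'n::finite \<Rightarrow> real" and s :: real
  assumes s: "0 < s" "s < 2" and u: "u \<in> L_space s" "u \<in> C11_loc S"
    and "x \<in> S" and min: "\<And>y. y \<in> S \<Longrightarrow> u x \<le> u y"
  shows "integrable lebesgue (\<lambda>y. (u x - u y) / norm (x - y) powr (real CARD('n) + s))"
proof -
  define p where "p = real CARD('n) + s"
  have p: "p > 0" using s by (simp add: p_def add_nonneg_pos)
  define f where "f y = (u x - u y) / norm (x - y) powr p" for y
  have [measurable]: "u \<in> borel_measurable lebesgue"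
    using u L1_loc_measurable by (auto simp: L_space_def)
  have [measurable]: "(\<lambda>y. norm (x - y) powr p) \<in> borel_measurable lebesgue"
    by (intro measurable_completion) measurable
  have [measurable]: "f \<in> borel_measurable lebesgue"
    unfolding f_def by measurable
  have [measurable]: "ball x \<rho> \<in> sets lebesgue" for \<rho> by auto
  obtain r L where r: "r > 0" and L: "\<And>y. dist x y < r \<Longrightarrow> \<bar>u x - u y\<bar> \<le> L * (dist x y)\<^sup>2"
    using C11_loc_minimum_quadratic[OF u(2) \<open>x \<in> S\<close> min] by blast
  have near: "integrable lebesgue (\<lambda>y. indicator (ball x r) y * f y)"
  proof (rule integrable_power_near_point[OF _ s r])
    show "\<bar>f y\<bar> \<le> L * (dist x y)\<^sup>2 / dist x y powr (real DIM(real ^ 'n) + s)" if "dist x y < r" for y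
      using L[OF that] by (simp add: f_def p_def abs_divide dist_norm divide_right_mono)
  qed measurable
  define q where "q y = 1 / (1 + norm y powr p)" for y :: "real ^ 'n"
  \<comment> \<open>The two summands absorb, outside the ball, the two terms of
    \<open>1 + norm y powr p\<close> into a multiple of \<open>norm (x - y) powr p\<close>: the
    first uses \<open>r <= norm (x - y)\<close>, the second
    \<open>norm y <= (norm x / r + 1) * norm (x - y)\<close>.\<close>
  define A where "A = r powr -p + (norm x / r + 1) powr p"
  have far: "integrable lebesgue (\<lambda>y. indicator (- ball x r) y * f y)"
  proof (rule Bochner_Integration.integrable_bound)
    have "integrable lebesgue q"
      unfolding q_def using s by (intro integrable_inverse_power_at_infinity) (simp add: p_def)
    moreover have "integrable lebesgue (\<lambda>y. \<bar>u y\<bar> / (1 + norm y powr p))"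
      using u by (simp add: L_space_def p_def)
    ultimately show "integrable lebesgue (\<lambda>y. A * (\<bar>u x\<bar> * q y + \<bar>u y\<bar> / (1 + norm y powr p)))"
      by auto
    show "AE y in lebesgue. norm (indicator (- ball x r) y * f y)
        \<le> norm (A * (\<bar>u x\<bar> * q y + \<bar>u y\<bar> / (1 + norm y powr p)))"
    proof (rule AE_I2)
      fix y :: "real ^ 'n"
      have pos: "1 + norm y powr p > 0" by (smt (verit) powr_ge_zero)
      have nn: "0 \<le> A * (\<bar>u x\<bar> * q y + \<bar>u y\<bar> / (1 + norm y powr p))"
        using pos by (auto simp: A_def q_def intro!: mult_nonneg_nonneg add_nonneg_nonneg)
      show "norm (indicator (- ball x r) y * f y)
        \<le> norm (A * (\<bar>u x\<bar> * q y + \<bar>u y\<bar> / (1 + norm y powr p)))"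
      proof (cases "y \<in> ball x r")
        case True
        then show ?thesis using nn by simp
      next
        case False
        define t where "t = norm (x - y)"
        have t: "r \<le> t" "t > 0" using False r by (auto simp: dist_norm t_def)
        have "norm y \<le> norm x + t"
          unfolding t_def by (metis norm_minus_commute norm_triangle_sub add.commute)
        also have "\<dots> \<le> (norm x / r + 1) * t"
          using t r mult_left_mono[of r t "norm x"] by (simp add: field_simps)
        finally have "norm y powr p \<le> ((norm x / r + 1) * t) powr p"
          using p by (intro powr_mono2) auto
        also have "\<dots> = (norm x / r + 1) powr p * t powr p"
          using r t by (intro powr_mult)
        finally have 1: "norm y powr p \<le> (norm x / r + 1) powr p * t powr p" .
        have "r powr p \<le> t powr p" using t r p by (intro powr_mono2) auto
        then have "1 \<le> r powr -p * t powr p"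
          using r by (simp add: powr_minus field_simps)
        with 1 have "1 + norm y powr p \<le> A * t powr p"
          by (simp add: A_def distrib_right)
        then have "1 / t powr p \<le> A * q y"
          using pos t by (simp add: q_def field_simps)
        then have "\<bar>u x - u y\<bar> * (1 / t powr p) \<le> (\<bar>u x\<bar> + \<bar>u y\<bar>) * (A * q y)"
          by (intro mult_mono) auto
        also have "\<dots> = A * (\<bar>u x\<bar> * q y + \<bar>u y\<bar> / (1 + norm y powr p))"
          by (simp add: q_def algebra_simps add_divide_distrib)
        finally have "\<bar>f y\<bar> \<le> A * (\<bar>u x\<bar> * q y + \<bar>u y\<bar> / (1 + norm y powr p))"
          by (simp add: f_def t_def abs_divide)
        then show ?thesis using False nn by simp
      qed
    qed
  qed measurable
  have "(\<lambda>y. indicator (ball x r) y * f y + indicator (- ball x r) y * f y) = f"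
    by (auto simp: indicator_def fun_eq_iff)
  with Bochner_Integration.integrable_add[OF near far] have "integrable lebesgue f"
    by simp
  then show ?thesis unfolding f_def p_def .
qed

section \<open>Upper bound for the fractional Laplacian at a negative minimum\<close>

lemma frac_const_pos:
  assumes "0 < s" "s < 2"
  shows "frac_const n s > 0"
  using assms by (auto simp: frac_const_def intro!: divide_pos_pos mult_pos_pos Gamma_real_pos)

text \<open>Only coordinate \<open>k\<close> changes, and the squared distances differ by
  \<open>4 * ((lam - x $ k) * (lam - y $ k))\<close>.\<close>

lemma norm_diff_le_norm_diff_reflect:
  assumes "x $ k \<le> lam" "y $ k \<le> lam"
  shows "norm (x - y) \<le> norm (x - reflect k lam y)"
  unfolding norm_eq_sqrt_inner inner_vec_def
proof (intro real_sqrt_le_mono sum_mono)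
  fix i
  have "0 \<le> 4 * ((lam - x $ k) * (lam - y $ k))" using assms by simp
  also have "\<dots> = (x $ k - (2 * lam - y $ k))\<^sup>2 - (x $ k - y $ k)\<^sup>2" by algebra
  finally show "inner ((x - y) $ i) ((x - y) $ i) \<le> inner ((x - reflect k lam y) $ i) ((x - reflect k lam y) $ i)"
    by (simp add: reflect_def power2_eq_square)
qed

text \<open>The free parameter \<open>D\<close> bounds the distance from \<open>x\<close> to the
  plane; taking it proportional to \<open>norm x\<close> yields the decay rate needed later.\<close>

lemma frac_laplacian_antisym_minimum_le:
  fixes V :: "real ^ 'n::finite \<Rightarrow> real" and s D :: real
  assumes s: "0 < s" "s < 2" and V: "V \<in> L_space s" "V \<in> C11_loc \<Omega>"
    and \<Omega>: "\<Omega> \<subseteq> half_space k lam" "x \<in> \<Omega>"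
    and anti: "\<And>y. V (reflect k lam y) = - V y"
    and min: "\<And>y. y \<in> half_space k lam \<Longrightarrow> V x \<le> V y" and neg: "V x < 0"
    and D: "D > 0" "lam \<le> x $ k + D"
  shows "frac_laplacian s V x \<le>
    frac_const CARD('n) s * unit_ball_vol CARD('n) / 3 powr (CARD('n) + s) * V x / D powr s"
proof -
  define p where "p = real CARD('n) + s"
  have p: "p > 0" using s by (simp add: p_def add_nonneg_pos)
  define f where "f y = (V x - V y) / norm (x - y) powr p" for y
  define R where "R = reflect k lam"
  have f_int: "integrable lebesgue f"
    unfolding f_def p_def using integrable_difference_quotient_at_minimum[OF s V \<Omega>(2)] min \<Omega>(1) by blast
  then have [measurable]: "f \<in> borel_measurable lebesgue" by auto
  have [measurable]: "R \<in> lebesgue \<rightarrow>\<^sub>M lebesgue" unfolding R_def by measurable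
  have dR: "distr lebesgue lebesgue R = lebesgue" unfolding R_def by (rule distr_lebesgue_reflect)
  have fR_int: "integrable lebesgue (\<lambda>y. f (R y))"
    using f_int integrable_distr_eq[of R lebesgue lebesgue f] by (simp add: dR)
  have fR: "(LINT y|lebesgue. f (R y)) = (LINT y|lebesgue. f y)"
    using integral_distr[of R lebesgue lebesgue f] by (simp add: dR)
  have x: "x $ k < lam" using \<Omega> by (auto simp: half_space_def)
  have R_hs: "R y \<in> half_space k lam" if "lam < y $ k" for y
    using that by (simp add: R_def reflect_def half_space_def)
  have plane: "V y = 0" if "y $ k = lam" for y
  proof -
    have "R y = y" using that by (simp add: R_def reflect_def vec_eq_iff)
    then show ?thesis using anti[of y] by (simp add: R_def)
  qed
  have right: "f y + f (R y) \<le> 2 * V x / norm (x - y) powr p" if y: "lam < y $ k" for y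
  \<comment> \<open>The numerator \<open>V x - V (R y)\<close> is nonpositive, so replacing its
    kernel by the smaller one at \<open>y\<close> can only increase the term. With a common kernel,
    antisymmetry cancels \<open>V y\<close> and leaves \<open>2 * V x\<close>.\<close>
  proof -
    have "V x \<le> V (R y)" using min R_hs y by simp
    moreover have "norm (x - R y) \<le> norm (x - y)"
      using norm_diff_le_norm_diff_reflect[of x k lam "R y"] x R_hs[OF y] by (simp add: R_def half_space_def)
    ultimately have "(V x - V (R y)) / norm (x - R y) powr p \<le> (V x - V (R y)) / norm (x - y) powr p"
    proof (cases "x = R y")
      case False
      then have "0 < norm (x - R y)" by simp
      with \<open>norm (x - R y) \<le> norm (x - y)\<close> have "0 < norm (x - y)" by linarith
      with \<open>0 < norm (x - R y)\<close> show ?thesis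
        using p \<open>V x \<le> V (R y)\<close> \<open>norm (x - R y) \<le> norm (x - y)\<close>
        by (intro divide_left_mono_neg powr_mono2 mult_pos_pos) auto
    qed simp
    then have "f (R y) \<le> (V x + V y) / norm (x - y) powr p"
      using anti[of y] by (simp add: f_def R_def)
    moreover have "f y = (V x - V y) / norm (x - y) powr p" by (simp add: f_def)
    ultimately have "f y + f (R y) \<le> (V x - V y) / norm (x - y) powr p + (V x + V y) / norm (x - y) powr p"
      by simp
    also have "\<dots> = 2 * V x / norm (x - y) powr p"
      by (simp flip: add_divide_distrib)
    finally show ?thesis .
  qed
  have nonpos: "f y + f (R y) \<le> 0" for y
  \<comment> \<open>The symmetrized integrand is unchanged when \<open>y\<close> and
    \<open>R y\<close> are swapped, so the near side reduces to the far side.\<close>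
  proof (rule linorder_cases[of "y $ k" lam])
    assume "y $ k < lam"
    then have "f (R y) + f (R (R y)) \<le> 2 * V x / norm (x - R y) powr p"
      by (intro right) (simp add: R_def reflect_def)
    also have "\<dots> \<le> 0" using neg by (simp add: divide_nonpos_nonneg)
    finally show ?thesis by (simp add: R_def add.commute)
  next
    assume "y $ k = lam"
    then have "V y = 0" "R y = y" using plane by (auto simp: R_def reflect_def vec_eq_iff)
    then show ?thesis using neg by (simp add: f_def divide_nonpos_nonneg)
  next
    assume "lam < y $ k"
    from right[OF this] neg show ?thesis
      by (smt (verit) divide_nonpos_nonneg powr_ge_zero)
  qed
  \<comment> \<open>A shift by \<open>2 * D\<close> places the centre at least \<open>D\<close>
    beyond the plane, so the ball of radius \<open>D\<close> lies on the far side and within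
    distance \<open>3 * D\<close> of \<open>x\<close>.\<close>
  define z where "z = x + (2 * D) *\<^sub>R axis k 1"
  have z: "lam < y $ k" "norm (x - y) \<le> 3 * D" if "y \<in> ball z D" for y
  proof -
    have "norm (z - y) < D" using that by (simp add: dist_norm)
    moreover have "\<bar>(z - y) $ k\<bar> \<le> norm (z - y)" by (rule component_le_norm_cart)
    ultimately show "lam < y $ k" using D by (simp add: z_def axis_def)
    have "norm (x - y) \<le> norm (x - z) + norm (z - y)"
      by (metis norm_triangle_ineq diff_add_cancel add_diff_eq)
    also have "norm (x - z) = 2 * D" using D by (simp add: z_def)
    finally show "norm (x - y) \<le> 3 * D" using \<open>norm (z - y) < D\<close> by simp
  qed
  have "2 * (LINT y|lebesgue. f y) = (LINT y|lebesgue. f y + f (R y))"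
    using f_int fR_int fR by simp
  also have "\<dots> \<le> (LINT y|lebesgue. indicator (ball z D) y * (2 * V x / (3 * D) powr p))"
  proof (rule integral_mono)
    show "integrable lebesgue (\<lambda>y. indicator (ball z D) y * (2 * V x / (3 * D) powr p))"
      by (intro integrable_mult_left integrable_real_indicator) (auto simp: emeasure_ball D less_imp_le)
    fix y
    show "f y + f (R y) \<le> indicator (ball z D) y * (2 * V x / (3 * D) powr p)"
    proof (cases "y \<in> ball z D")
      case True
      have "norm (x - y) > 0" using z(1)[OF True] x by auto
      then have "2 * V x / norm (x - y) powr p \<le> 2 * V x / (3 * D) powr p"
        using z(2)[OF True] p neg D by (intro divide_left_mono_neg powr_mono2 mult_pos_pos) auto
      with right[OF z(1)[OF True]] True show ?thesis by simp
    qed (use nonpos in simp)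
  qed (use f_int fR_int in auto)
  also have "\<dots> = unit_ball_vol CARD('n) * D ^ CARD('n) * (2 * V x / (3 * D) powr p)"
    using D content_ball[of D z] by (simp add: less_imp_le)
  \<comment> \<open>The volume factor \<open>D ^ CARD('n)\<close> cancels the dimensional part of
    the exponent \<open>p\<close>, leaving \<open>D powr s\<close>.\<close>
  also have "\<dots> = 2 * (unit_ball_vol CARD('n) * V x / 3 powr p / D powr s)"
    using D by (simp add: p_def powr_mult powr_add powr_realpow field_simps)
  finally have "(LINT y|lebesgue. f y) \<le> unit_ball_vol CARD('n) * V x / 3 powr p / D powr s"
    by simp
  then have "frac_const CARD('n) s * (LINT y|lebesgue. f y)
      \<le> frac_const CARD('n) s * (unit_ball_vol CARD('n) * V x / 3 powr p / D powr s)"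
    using frac_const_pos[OF s] by (intro mult_left_mono) (auto intro: less_imp_le)
  moreover have "frac_laplacian s V x = frac_const CARD('n) s * (LINT y|lebesgue. f y)"
    using frac_laplacian_eq_integral[of V x s] f_int by (simp add: f_def[abs_def] p_def)
  ultimately show ?thesis by (simp add: p_def)
qed

section \<open>Decay at infinity\<close>

lemma eventually_at_infinity_within:
  "eventually P (at_infinity_within S) \<longleftrightarrow> (\<exists>b. \<forall>x\<in>S. b \<le> norm x \<longrightarrow> P x)"
  by (auto simp: at_infinity_within_def eventually_inf_principal eventually_at_infinity)

theorem theorem1p3:
  fixes u v U V C\<^sub>1 C\<^sub>2 C\<^sub>3 :: "real ^ 'n::finite \<Rightarrow> real"
    and \<Omega> :: "(real ^ 'n) set"
    and k :: 'n
    and \<alpha> \<beta> lam m :: real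
  assumes dim: "CARD('n) \<ge> 2"
    and \<alpha>: "0 < \<alpha>" "\<alpha> < 2"
    and \<beta>: "0 < \<beta>" "\<beta> < 2"
    and \<Omega>: "region \<Omega>" "\<not> bounded \<Omega>" "\<Omega> \<subseteq> half_space k lam"
    and U_def: "\<And>x. U x = u (reflect k lam x) - u x"
    and V_def: "\<And>x. V x = v (reflect k lam x) - v x"
    and U_reg: "U \<in> L_space \<alpha> \<inter> C11_loc \<Omega>" "lower_semicontinuous_on (closure \<Omega>) U"
    and V_reg: "V \<in> L_space \<beta> \<inter> C11_loc \<Omega>" "lower_semicontinuous_on (closure \<Omega>) V"
    and ineq_U: "\<And>x. x \<in> \<Omega> \<Longrightarrow> frac_laplacian \<alpha> U x + C\<^sub>2 x * U x + C\<^sub>3 x * V x \<ge> 0"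
    and ineq_V: "\<And>x. x \<in> \<Omega> \<Longrightarrow> frac_laplacian \<beta> V x + C\<^sub>1 x * U x \<ge> 0"
    and nonneg: "\<And>x. x \<in> half_space k lam - \<Omega> \<Longrightarrow> U x \<ge> 0 \<and> V x \<ge> 0"
    and antisym: "\<And>x. x \<in> half_space k lam \<Longrightarrow>
          U (reflect k lam x) = - U x \<and> V (reflect k lam x) = - V x"
    and signs: "\<And>x. x \<in> \<Omega> \<Longrightarrow> C\<^sub>1 x < 0 \<and> C\<^sub>3 x < 0 \<and> C\<^sub>2 x > 0"
    and m: "m > \<beta>"
    and C1_decay: "comparable (at_infinity_within \<Omega>) (\<lambda>x. \<bar>C\<^sub>1 x\<bar>) (\<lambda>x. 1 / norm x powr m)"
    and C3_lim: "(C\<^sub>3 \<longlongrightarrow> 0) (at_infinity_within \<Omega>)"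
  shows "\<exists>R\<^sub>0>0. \<forall>x0\<in>\<Omega>. \<forall>x1\<in>\<Omega>.
           (\<forall>y\<in>\<Omega>. U x0 \<le> U y) \<and> U x0 < 0 \<and> (\<forall>y\<in>\<Omega>. V x1 \<le> V y) \<and> V x1 < 0
             \<longrightarrow> norm x0 \<le> R\<^sub>0 \<or> norm x1 \<le> R\<^sub>0"
proof (cases "\<exists>x0\<in>\<Omega>. \<exists>x1\<in>\<Omega>. (\<forall>y\<in>\<Omega>. U x0 \<le> U y) \<and> U x0 < 0 \<and> (\<forall>y\<in>\<Omega>. V x1 \<le> V y) \<and> V x1 < 0")
  case False
  then show ?thesis by (intro exI[of _ 1]) auto
next
  case True
  then obtain p0 p1 where p0: "p0 \<in> \<Omega>" "\<And>y. y \<in> \<Omega> \<Longrightarrow> U p0 \<le> U y" "U p0 < 0"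
    and p1: "p1 \<in> \<Omega>" "\<And>y. y \<in> \<Omega> \<Longrightarrow> V p1 \<le> V y" "V p1 < 0"
    by blast
  define K where "K = frac_const CARD('n) \<beta> * unit_ball_vol CARD('n) / 3 powr (CARD('n) + \<beta>)"
  have "K > 0" using frac_const_pos[OF \<beta>] by (simp add: K_def)
  obtain C where "C > 0" and "\<forall>\<^sub>F x in at_infinity_within \<Omega>. \<bar>C\<^sub>1 x\<bar> / (1 / norm x powr m) \<le> C"
    using C1_decay unfolding comparable_def by (fastforce simp: eventually_conj_iff)
  then obtain b where b: "\<And>x. x \<in> \<Omega> \<Longrightarrow> b \<le> norm x \<Longrightarrow> \<bar>C\<^sub>1 x\<bar> * norm x powr m \<le> C"
    unfolding eventually_at_infinity_within by auto
  \<comment> \<open>This is the bound on \<open>N powr (m - \<beta>)\<close> obtained by solving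
    \<open>K * (- V p1) / (2 * N) powr \<beta> <= C / N powr m * (- U p0)\<close>.\<close>
  define B where "B = C * (- U p0) * 2 powr \<beta> / (K * (- V p1))"
  define R\<^sub>0 where "R\<^sub>0 = Max {b, \<bar>lam\<bar> + 1, B powr (1 / (m - \<beta>))}"
  have R0: "b \<le> R\<^sub>0" "\<bar>lam\<bar> + 1 \<le> R\<^sub>0" "B powr (1 / (m - \<beta>)) \<le> R\<^sub>0"
    by (simp_all add: R\<^sub>0_def)
  have "norm x \<le> R\<^sub>0" if x: "x \<in> \<Omega>" "\<And>y. y \<in> \<Omega> \<Longrightarrow> V x \<le> V y" "V x < 0" for x
  proof (cases "norm x \<ge> \<bar>lam\<bar> + 1 \<and> norm x \<ge> b")
    case True
    define N where "N = norm x"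
    have N: "N > 0" "N \<ge> \<bar>lam\<bar> + 1" "N \<ge> b" using True by (auto simp: N_def)
    have Vx: "V x = V p1" using x p1 by (intro order.antisym) auto
    \<comment> \<open>Here \<open>D = 2 * N\<close> is admissible: \<open>x $ k >= - N\<close> and
      \<open>lam <= N\<close> give \<open>lam <= x $ k + 2 * N\<close>.\<close>
    have "\<bar>x $ k\<bar> \<le> N" unfolding N_def by (rule component_le_norm_cart)
    then have "frac_laplacian \<beta> V x \<le> K * V x / (2 * N) powr \<beta>"
      unfolding K_def using V_reg \<Omega> x N
    proof (intro frac_laplacian_antisym_minimum_le[OF \<beta>])
      show "V (reflect k lam y) = - V y" for y by (simp add: V_def)
      \<comment> \<open>Minimality passes from the region to the half space because \<open>V\<close>
        is nonnegative on the rest and \<open>V x < 0\<close>.\<close>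
      show "V x \<le> V y" if "y \<in> half_space k lam" for y
        using that nonneg[of y] x by (cases "y \<in> \<Omega>") force+
    qed auto
    with ineq_V[OF x(1)] have "0 \<le> K * V p1 / (2 * N) powr \<beta> + C\<^sub>1 x * U x"
      by (simp add: Vx)
    \<comment> \<open>Multiplying \<open>U p0 <= U x\<close> by the negative coefficient reverses
      it, which brings in the fixed value \<open>U p0\<close>.\<close>
    also have "C\<^sub>1 x * U x \<le> \<bar>C\<^sub>1 x\<bar> * (- U p0)"
      using signs[OF x(1)] p0(2)[OF x(1)] by simp
    also have "\<dots> \<le> C / N powr m * (- U p0)"
      using b[OF x(1)] N p0 by (intro mult_right_mono) (auto simp: N_def field_simps)
    finally have "K * (- V p1) / (2 * N) powr \<beta> \<le> C / N powr m * (- U p0)"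
      by simp
    moreover have "K * V p1 < 0" using p1 \<open>K > 0\<close> by (simp add: mult_pos_neg)
    ultimately have "N powr m / N powr \<beta> \<le> B"
      using N by (simp add: B_def powr_mult field_simps)
    then have "N powr (m - \<beta>) \<le> B" by (simp add: powr_diff)
    then have "(N powr (m - \<beta>)) powr (1 / (m - \<beta>)) \<le> B powr (1 / (m - \<beta>))"
      using m by (intro powr_mono2) auto
    then show ?thesis using N m R0 by (simp add: powr_powr N_def)
  qed (use R0 in auto)
  moreover have "R\<^sub>0 > 0" using R0 by linarith
  ultimately show ?thesis by blast
qed

end
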